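(* Let $P = \{x \in \mathcal{L} : Ax \le b\} \subseteq \mathbb{R}^n$ be a nonempty polyhedron, where $A \in \mathbb{R}^{m \times n}$ has rows $a^1,\dots,a^m$, $b \in \mathbb{R}^m$, and $\mathcal{L} \subseteq \mathbb{R}^n$ is an affine space with $\dim(P) = \dim(\mathcal{L})$ (so $\mathcal{L}$ is the affine hull of $P$). For each $i$ let $t^i \in \mathbb{R}^n$ be the vector that satisfies (i) $\|t^i\| = 1$, (ii) $t^i$ belongs to the linear direction space of $\mathcal{L}$, and (iii) $\{x \in \mathcal{L} : {a^i}^T x \le b_i\} = \{x \in \mathcal{L} : {t^i}^T x \le h_i\}$ for some $h_i \in \mathbb{R}$. Let $T \in \mathbb{R}^{m\times n}$ be the matrix whose $i$th row is $t^i$, and $h = (h_1,\dots,h_m)$, so that $P = \{x \in \mathcal{L} : Tx \le h\}$. Let $\alpha^T x \ge \beta$ be a cutting plane, i.e. an inequality valid for $P \cap \mathbb{Z}^n$. Then \[ \operatorname{depth}_P(\alpha,\beta) = \max\{\lambda \;:\; Tx + \lambda \mathbf{1} \le h,\ \alpha^T x \le \beta,\ x \in \mathcal{L},\ \lambda \ge 0\}, \] where $\mathbf{1}$ is the all-ones vector and the maximum is over $(x,\lambda)$; that is, the depth of the cutting plane is the optimal value of this linear optimization problem.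
   Context: $\|\cdot\|$ is the Euclidean norm on $\mathbb{R}^n$, and $B(x,r) := \{y \in \mathbb{R}^n : \|y-x\| \le r\}$ for $r \in \mathbb{R}_+$. For $P \subseteq \mathbb{R}^n$ and $x \in P$, $\operatorname{depth}_P(x) := \sup\{ r \in \mathbb{R}_+ : B(x,r) \cap \operatorname{aff}(P) \subseteq P\}$, where $\operatorname{aff}(P)$ is the affine hull of $P$. For $S \subseteq P$, $\operatorname{depth}_P(S) := \sup\{\operatorname{depth}_P(x) : x \in P \setminus S\}$. For an inequality $\alpha^T x \ge \beta$ valid for $P \cap \mathbb{Z}^n$, $\operatorname{depth}_P(\alpha,\beta) := \operatorname{depth}_P(\{x \in P : \alpha^T x \ge \beta\})$. The linear direction space of an affine space $\mathcal{L}$ is $\{u-w : u,w \in \mathcal{L}\}$; the vector $t^i$ can be obtained by projecting $a^i$ orthogonally onto this space and then normalizing.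
   Formalization: Adds the assumption that P is not contained in the hyperplane {α^T x = β}; otherwise the claim fails: for P = [1/4, 3/4], α = 0, β = 0 the depth is the supremum of the empty set (0), while the optimal value is 1/4. *)

theory Defs
  imports "HOL-Analysis.Analysis"
begin

text \<open>
  Depths are suprema of nonnegative radii and may be infinite (a single point has depth
  \<open>\<infinity>\<close> in itself, since its affine hull is itself). They therefore live in \<open>[0, \<infinity>]\<close>, where
  the supremum of the empty set is \<open>0\<close>.
\<close>

definition point_depth :: "(real ^ 'n) set \<Rightarrow> real ^ 'n \<Rightarrow> ennreal" where
  "point_depth P x = Sup {ennreal r | r. 0 \<le> r \<and> cball x r \<inter> affine hull P \<subseteq> P}"

definition set_depth :: "(real ^ 'n) set \<Rightarrow> (real ^ 'n) set \<Rightarrow> ennreal" where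
  "set_depth P S = (SUP x \<in> P - S. point_depth P x)"

definition cut_depth :: "(real ^ 'n) set \<Rightarrow> real ^ 'n \<Rightarrow> real \<Rightarrow> ennreal" where
  "cut_depth P \<alpha> \<beta> = set_depth P {x \<in> P. \<alpha> \<bullet> x \<ge> \<beta>}"

definition int_lattice :: "(real ^ 'n) set" where
  "int_lattice = {x. \<forall>j. x $ j \<in> \<int>}"

definition cutting_plane :: "(real ^ 'n) set \<Rightarrow> real ^ 'n \<Rightarrow> real \<Rightarrow> bool" where
  "cutting_plane P \<alpha> \<beta> \<longleftrightarrow> (\<forall>x \<in> P \<inter> int_lattice. \<alpha> \<bullet> x \<ge> \<beta>)"

definition direction_space :: "(real ^ 'n) set \<Rightarrow> (real ^ 'n) set" where
  "direction_space L = {u - w | u w. u \<in> L \<and> w \<in> L}"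

text \<open>
  An \<open>m \<times> n\<close> matrix is given by its rows \<open>a 0, \<dots>, a (m - 1)\<close>, so that \<open>m = 0\<close> (no
  inequalities) is allowed.
\<close>

definition polyhedron_in :: "(real ^ 'n) set \<Rightarrow> nat \<Rightarrow> (nat \<Rightarrow> real ^ 'n) \<Rightarrow> (nat \<Rightarrow> real) \<Rightarrow> (real ^ 'n) set" where
  "polyhedron_in L m a b = {x \<in> L. \<forall>i<m. a i \<bullet> x \<le> b i}"

definition depth_lp_feasible ::
  "(real ^ 'n) set \<Rightarrow> nat \<Rightarrow> (nat \<Rightarrow> real ^ 'n) \<Rightarrow> (nat \<Rightarrow> real) \<Rightarrow> real ^ 'n \<Rightarrow> real \<Rightarrow> ((real ^ 'n) \<times> real) set" where
  "depth_lp_feasible L m t h \<alpha> \<beta> =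
     {(x, l). (\<forall>i<m. t i \<bullet> x + l \<le> h i) \<and> \<alpha> \<bullet> x \<le> \<beta> \<and> x \<in> L \<and> l \<ge> 0}"

end

(* The normalisation of the t i makes the slack h i - t i . x the distance, within L, from x to the
   boundary of the i-th half-space, so a ball of radius r around x in L lies in P iff every slack is
   at least r. The linear programme relaxes alpha . x < beta to a weak inequality; this does not
   change the supremum, because a feasible point with alpha . x = beta and positive slack can be
   moved slightly along a line on which alpha is not constant. That the supremum is attained, if
   finite, is the fact that a linear function bounded above on a polyhedron has a maximiser. *)

theory Submission
  imports Defs
begin

text \<open>
  Induction on the number of constraints, for all affine spaces at once: unless the new constraint
  is satisfied by a maximiser of the relaxed problem, every feasible point is dominated by a relaxed
  point violating it, hence, along the segment, by a point of the hyperplane where it is tight.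
\<close>

lemma linear_attains_max_on_polyhedron:
  fixes F :: "('a::euclidean_space \<times> real) set" and c :: 'a
  assumes "finite F" "affine L"
    and "{x \<in> L. \<forall>(a, b)\<in>F. a \<bullet> x \<le> b} \<noteq> {}"
    and "\<And>x. x \<in> L \<Longrightarrow> \<forall>(a, b)\<in>F. a \<bullet> x \<le> b \<Longrightarrow> c \<bullet> x \<le> M"
  shows "\<exists>x\<in>L. (\<forall>(a, b)\<in>F. a \<bullet> x \<le> b) \<and>
           (\<forall>y\<in>L. (\<forall>(a, b)\<in>F. a \<bullet> y \<le> b) \<longrightarrow> c \<bullet> y \<le> c \<bullet> x)"
  using assms
proof (induction F arbitrary: L M rule: finite_induct)
  case empty
  then obtain x where x: "x \<in> L" by auto
  have "c \<bullet> y \<le> c \<bullet> x" if y: "y \<in> L" for y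
  proof (rule ccontr)
    assume "\<not> c \<bullet> y \<le> c \<bullet> x"
    then have pos: "c \<bullet> (y - x) > 0" by (simp add: inner_diff_right)
    \<comment> \<open>An affine space contains the whole line through \<open>x\<close> and
      \<open>y\<close>; \<open>s\<close> is the parameter at which \<open>c\<close> takes the value
      \<open>M + 1\<close> on it.\<close>
    define s where "s = (M - c \<bullet> x + 1) / (c \<bullet> (y - x))"
    have "x + s *\<^sub>R (y - x) \<in> L" using empty.prems(1) x y by (intro mem_affine_3_minus)
    then have "c \<bullet> (x + s *\<^sub>R (y - x)) \<le> M" using empty.prems(3) by auto
    moreover have "c \<bullet> (x + s *\<^sub>R (y - x)) = c \<bullet> x + s * (c \<bullet> (y - x))"
      by (simp only: inner_add_right inner_scaleR_right)
    moreover have "s * (c \<bullet> (y - x)) = M - c \<bullet> x + 1" using pos by (simp add: s_def)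
    ultimately show False by linarith
  qed
  with x show ?case by auto
next
  case (insert p F)
  obtain a0 b0 where p: "p = (a0, b0)" by (cases p)
  define S where "S = {x \<in> L. \<forall>(a, b)\<in>F. a \<bullet> x \<le> b}"
  have S_comb: "u *\<^sub>R x + v *\<^sub>R y \<in> S" if "x \<in> S" "y \<in> S" "u \<ge> 0" "v \<ge> 0" "u + v = 1" for x y u v
  proof -
    have "a \<bullet> (u *\<^sub>R x + v *\<^sub>R y) \<le> b" if "(a, b) \<in> F" for a b
    proof -
      have "a \<bullet> x \<le> b" "a \<bullet> y \<le> b" using \<open>x \<in> S\<close> \<open>y \<in> S\<close> that by (auto simp: S_def)
      then have "u * (a \<bullet> x) + v * (a \<bullet> y) \<le> u * b + v * b"
        using \<open>u \<ge> 0\<close> \<open>v \<ge> 0\<close> by (intro add_mono mult_left_mono)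
      also have "\<dots> = b" using \<open>u + v = 1\<close> by (simp flip: distrib_right)
      finally show ?thesis by (simp add: inner_add_right)
    qed
    moreover have "u *\<^sub>R x + v *\<^sub>R y \<in> L"
      using that insert.prems(1) by (intro mem_affine) (auto simp: S_def)
    ultimately show ?thesis by (auto simp: S_def)
  qed
  show ?case
  proof (cases "\<exists>x\<in>S. a0 \<bullet> x \<le> b0 \<and> (\<forall>y\<in>S. c \<bullet> y \<le> c \<bullet> x)")
    case True
    then show ?thesis by (auto simp: S_def p)
  next
    case False
    have above: "\<exists>z\<in>S. c \<bullet> y \<le> c \<bullet> z \<and> a0 \<bullet> z > b0" if y: "y \<in> S" "a0 \<bullet> y \<le> b0" for y
    \<comment> \<open>\<open>M\<close> bounds \<open>c\<close> only where the new constraint holds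
      too, so on the relaxed set \<open>S\<close> boundedness has to be decided first. If it holds,
      the induction hypothesis yields a maximiser over \<open>S\<close>, which violates the new
      constraint because the outer case fails.\<close>
    proof (cases "\<exists>N. \<forall>z\<in>S. c \<bullet> z \<le> N")
      case True
      then obtain N where "\<forall>z\<in>S. c \<bullet> z \<le> N" ..
      then have "\<exists>x\<in>L. (\<forall>(a, b)\<in>F. a \<bullet> x \<le> b) \<and>
          (\<forall>z\<in>L. (\<forall>(a, b)\<in>F. a \<bullet> z \<le> b) \<longrightarrow> c \<bullet> z \<le> c \<bullet> x)"
        using insert.prems(1) y by (intro insert.IH[where M = N]) (auto simp: S_def)
      then have "\<exists>x\<in>S. \<forall>z\<in>S. c \<bullet> z \<le> c \<bullet> x" unfolding S_def by blast
      with False y show ?thesis by (meson not_le)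
    next
      case False
      \<comment> \<open>Exceeding \<open>M\<close> forces \<open>z\<close> to violate the new
        constraint; exceeding \<open>c \<bullet> y\<close> makes it dominate
        \<open>y\<close>.\<close>
      then obtain z where "z \<in> S" "c \<bullet> z > max M (c \<bullet> y)" by (meson not_le)
      moreover from this have "a0 \<bullet> z > b0"
        using insert.prems(3)[of z] by (force simp: S_def p)
      ultimately show ?thesis by (intro bexI[of _ z]) auto
    qed
    have tight: "\<exists>z\<in>S. c \<bullet> y \<le> c \<bullet> z \<and> a0 \<bullet> z = b0" if y: "y \<in> S" "a0 \<bullet> y \<le> b0" for y
    proof -
      obtain z where z: "z \<in> S" "c \<bullet> y \<le> c \<bullet> z" "a0 \<bullet> z > b0" using above[OF y] by blast
      define u where "u = (b0 - a0 \<bullet> y) / (a0 \<bullet> z - a0 \<bullet> y)"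
      have u: "0 \<le> u" "u \<le> 1" using y z by (auto simp: u_def)
      have "u * (a0 \<bullet> z - a0 \<bullet> y) = b0 - a0 \<bullet> y" using y z by (simp add: u_def)
      then have "a0 \<bullet> ((1 - u) *\<^sub>R y + u *\<^sub>R z) = b0"
        by (simp add: inner_add_right algebra_simps)
      moreover have "u * (c \<bullet> y) \<le> u * (c \<bullet> z)" using u z by (intro mult_left_mono)
      then have "c \<bullet> y \<le> c \<bullet> ((1 - u) *\<^sub>R y + u *\<^sub>R z)"
        by (simp add: inner_add_right algebra_simps)
      moreover have "(1 - u) *\<^sub>R y + u *\<^sub>R z \<in> S" using y z u by (intro S_comb) auto
      ultimately show ?thesis by blast
    qed
    \<comment> \<open>The tight constraint is absorbed into the affine space, so the induction
      hypothesis applies with the same \<open>F\<close>. By \<open>tight\<close>, a maximiser on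
      this slice dominates every feasible point.\<close>
    define L' where "L' = L \<inter> {x. a0 \<bullet> x = b0}"
    have "affine L'" unfolding L'_def using insert.prems(1) by (intro affine_Int affine_hyperplane)
    obtain y0 where "y0 \<in> S" "a0 \<bullet> y0 \<le> b0" using insert.prems(2) by (auto simp: S_def p)
    from tight[OF this] have "{x \<in> L'. \<forall>(a, b)\<in>F. a \<bullet> x \<le> b} \<noteq> {}"
      by (auto simp: S_def L'_def)
    from insert.IH[OF \<open>affine L'\<close> this, of M] insert.prems(3)
    obtain x where x: "x \<in> S" "a0 \<bullet> x = b0" and
      mx: "\<And>y. y \<in> S \<Longrightarrow> a0 \<bullet> y = b0 \<Longrightarrow> c \<bullet> y \<le> c \<bullet> x"
      by (auto simp: S_def L'_def p)
    have "c \<bullet> y \<le> c \<bullet> x" if "y \<in> S" "a0 \<bullet> y \<le> b0" for y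
      using tight[OF that] mx by force
    with x show ?thesis by (intro bexI[of _ x]) (auto simp: S_def p)
  qed
qed

text \<open>The point \<open>x + r *\<^sub>R t i\<close> stays in \<open>L\<close> because
  \<open>t i\<close> is a direction of \<open>L\<close>, and it maximises \<open>t i\<close> over
  the ball, with value \<open>t i \<bullet> x + r\<close>. Conversely, Cauchy-Schwarz bounds the
  increase of \<open>t i\<close> over the ball by \<open>r\<close>.\<close>

lemma cball_Int_affine_subset_iff_slack:
  assumes "affine L" "x \<in> L" "0 \<le> r"
    and "\<And>i. i < m \<Longrightarrow> norm (t i) = 1"
    and "\<And>i. i < m \<Longrightarrow> t i \<in> direction_space L"
  shows "cball x r \<inter> L \<subseteq> polyhedron_in L m t h \<longleftrightarrow> (\<forall>i<m. t i \<bullet> x + r \<le> h i)"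
proof (intro iffI allI impI subsetI)
  fix i assume sub: "cball x r \<inter> L \<subseteq> polyhedron_in L m t h" and i: "i < m"
  obtain u w where uw: "t i = u - w" "u \<in> L" "w \<in> L"
    using assms(5)[OF i] by (auto simp: direction_space_def)
  have "x + r *\<^sub>R t i \<in> L" unfolding uw(1) using assms uw by (intro mem_affine_3_minus)
  moreover have "x + r *\<^sub>R t i \<in> cball x r" using assms(3) assms(4)[OF i] by (simp add: dist_norm)
  ultimately have "t i \<bullet> (x + r *\<^sub>R t i) \<le> h i" using sub i by (auto simp: polyhedron_in_def)
  moreover have "t i \<bullet> t i = 1" using assms(4)[OF i] by (simp add: norm_eq_1)
  ultimately show "t i \<bullet> x + r \<le> h i" by (simp add: inner_add_right)
next
  fix y assume slack: "\<forall>i<m. t i \<bullet> x + r \<le> h i" and y: "y \<in> cball x r \<inter> L"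
  have "t i \<bullet> y \<le> h i" if i: "i < m" for i
  proof -
    have "t i \<bullet> (y - x) \<le> norm (t i) * norm (y - x)" by (rule norm_cauchy_schwarz)
    also have "\<dots> \<le> r" using assms(4)[OF i] y by (simp add: dist_norm norm_minus_commute)
    finally show ?thesis using slack i by (auto simp: inner_diff_right)
  qed
  with y show "y \<in> polyhedron_in L m t h" by (simp add: polyhedron_in_def)
qed

text \<open>The nested supremum, over points cut off and then over their admissible radii, becomes
  one supremum over pairs. Nonnegative \<open>l\<close> makes the \<open>x\<close> of such a pair a
  point of \<open>P\<close>.\<close>

lemma cut_depth_eq_SUP_strictly_cut:
  assumes "affine L" "P = polyhedron_in L m t h" "affine hull P = L"
    and "\<And>i. i < m \<Longrightarrow> norm (t i) = 1"
    and "\<And>i. i < m \<Longrightarrow> t i \<in> direction_space L"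
  shows "cut_depth P \<alpha> \<beta> =
    (SUP (x, l) \<in> {(x, l) \<in> depth_lp_feasible L m t h \<alpha> \<beta>. \<alpha> \<bullet> x < \<beta>}. ennreal l)"
    (is "_ = (SUP (x, l) \<in> ?F. ennreal l)")
proof -
  have ball: "cball x r \<inter> affine hull P \<subseteq> P \<longleftrightarrow> (\<forall>i<m. t i \<bullet> x + r \<le> h i)"
    if "x \<in> L" "0 \<le> r" for x r
    using cball_Int_affine_subset_iff_slack[of L x r m t h] assms that by simp
  show ?thesis
  proof (rule antisym)
    show "cut_depth P \<alpha> \<beta> \<le> (SUP (x, l) \<in> ?F. ennreal l)"
      unfolding cut_depth_def set_depth_def point_depth_def
    proof (intro SUP_least Sup_least)
      fix x d assume x: "x \<in> P - {x \<in> P. \<beta> \<le> \<alpha> \<bullet> x}"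
        and "d \<in> {ennreal r |r. 0 \<le> r \<and> cball x r \<inter> affine hull P \<subseteq> P}"
      then obtain r where r: "d = ennreal r" "0 \<le> r" "cball x r \<inter> affine hull P \<subseteq> P" by blast
      have "x \<in> L" using x assms(2) by (simp add: polyhedron_in_def)
      with x r have "(x, r) \<in> ?F" by (auto simp: depth_lp_feasible_def ball)
      from SUP_upper[OF this, of "\<lambda>(x, l). ennreal l"] r(1)
      show "d \<le> (SUP (x, l) \<in> ?F. ennreal l)" by simp
    qed
    show "(SUP (x, l) \<in> ?F. ennreal l) \<le> cut_depth P \<alpha> \<beta>"
    proof (rule SUP_least, clarify)
      fix x l assume F: "(x, l) \<in> depth_lp_feasible L m t h \<alpha> \<beta>" "\<alpha> \<bullet> x < \<beta>"
      then have l: "x \<in> L" "0 \<le> l" "\<forall>i<m. t i \<bullet> x + l \<le> h i" by (auto simp: depth_lp_feasible_def)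
      then have "x \<in> P" unfolding assms(2) by (force simp: polyhedron_in_def)
      have "ennreal l \<le> point_depth P x"
        unfolding point_depth_def using ball l by (intro Sup_upper) blast
      also have "\<dots> \<le> cut_depth P \<alpha> \<beta>"
        unfolding cut_depth_def set_depth_def using \<open>x \<in> P\<close> F by (intro SUP_upper) auto
      finally show "ennreal l \<le> cut_depth P \<alpha> \<beta>" .
    qed
  qed
qed

text \<open>The point \<open>y\<close> supplies a line through \<open>x\<close> in \<open>L\<close>
  on which \<alpha> is not constant. As the \<open>t i\<close> are unit vectors, a move of length
  \<delta> costs at most \<delta> of slack.\<close>

lemma SUP_depth_lp_feasible_strict:
  assumes "affine L" "y \<in> L" "\<alpha> \<bullet> y \<noteq> \<beta>"
    and "\<And>i. i < m \<Longrightarrow> norm (t i) = 1"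
  shows "(SUP (x, l) \<in> {(x, l) \<in> depth_lp_feasible L m t h \<alpha> \<beta>. \<alpha> \<bullet> x < \<beta>}. ennreal l) =
    (SUP (x, l) \<in> depth_lp_feasible L m t h \<alpha> \<beta>. ennreal l)"
    (is "(SUP (x, l) \<in> ?F. ennreal l) = _")
proof (rule antisym)
  show "(SUP (x, l) \<in> ?F. ennreal l) \<le> (SUP (x, l) \<in> depth_lp_feasible L m t h \<alpha> \<beta>. ennreal l)"
    by (rule SUP_subset_mono) auto
  show "(SUP (x, l) \<in> depth_lp_feasible L m t h \<alpha> \<beta>. ennreal l) \<le> (SUP (x, l) \<in> ?F. ennreal l)"
  proof (rule SUP_least, clarify)
    fix x l assume F: "(x, l) \<in> depth_lp_feasible L m t h \<alpha> \<beta>"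
    then have x: "x \<in> L" "0 \<le> l" "\<alpha> \<bullet> x \<le> \<beta>" "\<And>i. i < m \<Longrightarrow> t i \<bullet> x + l \<le> h i"
      by (auto simp: depth_lp_feasible_def)
    have upper: "ennreal k \<le> (SUP (x, l) \<in> ?F. ennreal l)" if "(z, k) \<in> ?F" for z k
      using SUP_upper[OF that, of "\<lambda>(x, l). ennreal l"] by simp
    show "ennreal l \<le> (SUP (x, l) \<in> ?F. ennreal l)"
    proof (cases "\<alpha> \<bullet> x < \<beta>")
      case True
      with F show ?thesis by (intro upper[of x]) auto
    next
      case False
      then have eq: "\<alpha> \<bullet> x = \<beta>" using x by simp
      show ?thesis
      \<comment> \<open>It suffices to reach every real \<open>k < l\<close>; the difference
        \<open>l - k\<close> is the slack spent on the move. For \<open>l = 0\<close> there is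
        nothing to reach.\<close>
      proof (rule dense_le)
        fix d assume d: "d < ennreal l"
        then obtain k where k: "d = ennreal k" "0 \<le> k" by (cases d) auto
        with d have kl: "k < l" by (simp add: ennreal_less_iff)
        \<comment> \<open>Scaled so that the displacement has norm at most \<open>l - k\<close>;
          adding 1 keeps the denominator positive.\<close>
        define e where "e = (l - k) / (norm (y - x) + 1)"
        have e: "e > 0" "e * norm (y - x) \<le> l - k"
        proof -
          show "e > 0" using kl by (auto simp: e_def intro!: divide_pos_pos add_nonneg_pos)
          then have "e * norm (y - x) \<le> e * (norm (y - x) + 1)" by simp
          also have "\<dots> = l - k"
            using norm_ge_zero[of "y - x"] by (simp add: e_def add_nonneg_eq_0_iff)
          finally show "e * norm (y - x) \<le> l - k" .
        qed
        \<comment> \<open>Towards \<open>y\<close> if \<open>y\<close> is strictly cut off, away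
          from it otherwise, so that \<alpha> decreases in both cases.\<close>
        define s where "s = (if \<alpha> \<bullet> y < \<beta> then e else - e)"
        define z where "z = x + s *\<^sub>R (y - x)"
        have "z \<in> L" unfolding z_def using assms x by (intro mem_affine_3_minus)
        moreover have "s * (\<alpha> \<bullet> y - \<beta>) < 0"
          using assms(3) e(1) by (auto simp: s_def mult_less_0_iff)
        then have "\<alpha> \<bullet> z < \<beta>" by (simp add: z_def inner_add_right inner_diff_right eq)
        moreover have "t i \<bullet> z + k \<le> h i" if i: "i < m" for i
        proof -
          have "t i \<bullet> (s *\<^sub>R (y - x)) \<le> norm (t i) * norm (s *\<^sub>R (y - x))"
            by (rule norm_cauchy_schwarz)
          also have "\<dots> \<le> l - k" using e assms(4)[OF i] by (simp add: s_def)
          finally have "t i \<bullet> (s *\<^sub>R (y - x)) \<le> l - k" .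
          moreover have "t i \<bullet> z = t i \<bullet> x + t i \<bullet> (s *\<^sub>R (y - x))"
            unfolding z_def by (rule inner_add_right)
          ultimately show ?thesis using x(4)[OF i] by linarith
        qed
        ultimately have "(z, k) \<in> ?F" using k by (auto simp: depth_lp_feasible_def)
        then show "d \<le> (SUP (x, l) \<in> ?F. ennreal l)" unfolding k(1) by (rule upper)
      qed
    qed
  qed
qed

text \<open>The programme maximises the linear functional \<open>(0, 1)\<close> over a polyhedron in
  the affine space \<open>L \<times> UNIV\<close>; a finite supremum in \<open>ennreal\<close>
  supplies the real bound that the maximiser lemma asks for.\<close>

lemma depth_lp_attained:
  assumes "affine L" "depth_lp_feasible L m t h \<alpha> \<beta> \<noteq> {}"
    and fin: "(SUP (x, l) \<in> depth_lp_feasible L m t h \<alpha> \<beta>. ennreal l) < \<infinity>"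
  shows "\<exists>(x, l) \<in> depth_lp_feasible L m t h \<alpha> \<beta>.
    (SUP (x, l) \<in> depth_lp_feasible L m t h \<alpha> \<beta>. ennreal l) = ennreal l"
proof -
  let ?D = "depth_lp_feasible L m t h \<alpha> \<beta>"
  \<comment> \<open>In order: the cut, the sign condition written as \<open>- l \<le> 0\<close>, and
    the slack constraints with coefficient 1 on \<open>l\<close>.\<close>
  define F where "F = insert ((\<alpha>, 0::real), \<beta>)
    (insert ((0, - 1), 0) ((\<lambda>i. ((t i, 1), h i)) ` {..<m}))"
  have D: "p \<in> L \<times> UNIV \<and> (\<forall>(a, b)\<in>F. a \<bullet> p \<le> b) \<longleftrightarrow> p \<in> ?D" for p
    by (cases p) (auto simp: F_def depth_lp_feasible_def inner_Pair)
  obtain M where M: "(SUP (x, l) \<in> ?D. ennreal l) = ennreal M" "0 \<le> M"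
    using fin by (cases "SUP (x, l) \<in> ?D. ennreal l") auto
  have upper: "ennreal (snd p) \<le> (SUP (x, l) \<in> ?D. ennreal l)" if "p \<in> ?D" for p
    using SUP_upper[OF that, of "\<lambda>(x, l). ennreal l"] by (simp add: case_prod_beta)
  then have bound: "snd p \<le> M" if "p \<in> ?D" for p using that M by (metis ennreal_le_iff)
  have snd_inner: "(0, 1) \<bullet> p = snd p" for p :: "(real ^ 'n) \<times> real" by (cases p) simp
  have aff: "affine (L \<times> (UNIV :: real set))"
    using assms(1) unfolding affine_def by auto
  have ne: "{p \<in> L \<times> UNIV. \<forall>(a, b)\<in>F. a \<bullet> p \<le> b} \<noteq> {}" using assms(2) D by blast
  have "(0, 1) \<bullet> p \<le> M" if "p \<in> L \<times> UNIV" "\<forall>(a, b)\<in>F. a \<bullet> p \<le> b" for p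
    unfolding snd_inner by (rule bound) (rule D[THEN iffD1, OF conjI[OF that]])
  from linear_attains_max_on_polyhedron[OF _ aff ne this]
  have "\<exists>q\<in>L \<times> UNIV. (\<forall>(a, b)\<in>F. a \<bullet> q \<le> b) \<and>
      (\<forall>p\<in>L \<times> UNIV. (\<forall>(a, b)\<in>F. a \<bullet> p \<le> b) \<longrightarrow> snd p \<le> snd q)"
    unfolding snd_inner by (simp only: F_def finite_insert finite_imageI finite_lessThan)
  then obtain q where "q \<in> ?D" "\<forall>p\<in>?D. snd p \<le> snd q"
    unfolding D[symmetric] Ball_def by blast
  then have q: "q \<in> ?D" "\<And>p. p \<in> ?D \<Longrightarrow> snd p \<le> snd q" by auto
  have "(SUP (x, l) \<in> ?D. ennreal l) \<le> ennreal (snd q)"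
    using q(2) by (intro SUP_least) (force intro!: ennreal_leI)
  with upper[OF q(1)] have "(SUP (x, l) \<in> ?D. ennreal l) = ennreal (snd q)" by (rule antisym[rotated])
  with q(1) show ?thesis by (intro bexI[of _ q]) (auto simp: case_prod_beta)
qed

text \<open>If \<open>P\<close> lay in the hyperplane \<open>\<alpha> \<bullet> x = \<beta>\<close>,
  no point would be strictly cut off and the depth would be 0, while a relative interior point of
  \<open>P\<close> gives the programme a positive value; the last hypothesis excludes this. An
  infeasible programme has supremum 0 in \<open>ennreal\<close> but no maximiser, and an infinite
  value is not attained by a real \<open>l\<close>; hence the premises of the second
  conjunct.\<close>

theorem mainTheorem7:
  fixes L P :: "(real ^ 'n) set" and m :: nat
    and a t :: "nat \<Rightarrow> real ^ 'n" and b h :: "nat \<Rightarrow> real"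
    and \<alpha> :: "real ^ 'n" and \<beta> :: real
  assumes "affine L"
    and "P = polyhedron_in L m a b"
    and "P \<noteq> {}"
    and "aff_dim P = aff_dim L"
    and "\<And>i. i < m \<Longrightarrow> norm (t i) = 1"
    and "\<And>i. i < m \<Longrightarrow> t i \<in> direction_space L"
    and "\<And>i. i < m \<Longrightarrow> {x \<in> L. a i \<bullet> x \<le> b i} = {x \<in> L. t i \<bullet> x \<le> h i}"
    and "cutting_plane P \<alpha> \<beta>"
    and "\<not> P \<subseteq> {x. \<alpha> \<bullet> x = \<beta>}"
  shows "cut_depth P \<alpha> \<beta> = (SUP (x, l) \<in> depth_lp_feasible L m t h \<alpha> \<beta>. ennreal l)
    \<and> (depth_lp_feasible L m t h \<alpha> \<beta> \<noteq> {} \<and> cut_depth P \<alpha> \<beta> < \<infinity> \<longrightarrow>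
        (\<exists>(x, l) \<in> depth_lp_feasible L m t h \<alpha> \<beta>. cut_depth P \<alpha> \<beta> = ennreal l))"
proof -
  \<comment> \<open>Condition (iii) equates the two half-spaces only within \<open>L\<close>, which
    is enough because \<open>polyhedron_in\<close> intersects with \<open>L\<close>.\<close>
  have P: "P = polyhedron_in L m t h"
    using assms(2,7) by (auto simp: polyhedron_in_def set_eq_iff)
  have "P \<subseteq> L" using assms(2) by (auto simp: polyhedron_in_def)
  have hull: "affine hull P = L"
    using affine_dim_equal[of "affine hull P" L] assms(1,3,4) \<open>P \<subseteq> L\<close>
    by (simp add: hull_minimal)
  obtain y where y: "y \<in> L" "\<alpha> \<bullet> y \<noteq> \<beta>" using assms(9) \<open>P \<subseteq> L\<close> by auto
  have eq: "cut_depth P \<alpha> \<beta> = (SUP (x, l) \<in> depth_lp_feasible L m t h \<alpha> \<beta>. ennreal l)"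
    using cut_depth_eq_SUP_strictly_cut[OF assms(1) P hull assms(5,6)]
      SUP_depth_lp_feasible_strict[OF assms(1) y assms(5)] by simp
  with depth_lp_attained[OF assms(1)] show ?thesis by simp
qed

end
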